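(* Let $G$ be a connected graph, $(G,\phi,\Gamma)$ a gain graph, and $\mathcal B$ a collection of circuits of $G$. (a) Let $(G^\phi,\Psi)$ be the associated ordinary derived covering. Then $\phi$ is balanced on (every circuit of) $\mathcal B$ if and only if the covering $(G^\phi,\Psi)$ preserves $\mathcal B$. (b) If $\Gamma=S_m$ is a symmetric group (with $m$ a positive integer or $m=\infty$), let $(G^\sigma,\Psi)$ be the associated permutation derived covering. Then $\phi$ is balanced on $\mathcal B$ if and only if the covering $(G^\sigma,\Psi)$ preserves $\mathcal B$.
   Context: Graphs are simple and undirected, $G=(V,E)$; $\vec E$ contains both arcs $xy,yx$ for every edge. A circuit $C=(x_1,\dots,x_n)$ is a simple closed walk (simple cycle, $n\ge 3$). A gain graph is a triple $(G,\phi,\Gamma)$ with $\Gamma$ a group and $\phi:\vec E\to\Gamma$ satisfying $\phi(xy)=\phi(yx)^{-1}$; $\phi$ is balanced on $C$ if $\phi(x_1x_2)\cdots\phi(x_{n-1}x_n)\phi(x_nx_1)=e_\Gamma$. A covering of a connected graph $G$ is a pair $(\widetilde G,\Psi)$ with $\Psi:\widetilde G\to G$ a surjective graph homomorphism mapping, for each vertex $\widetilde x$, the neighbors of $\widetilde x$ bijectively onto the neighbors of $\Psi(\widetilde x)$. It preserves $\mathcal B$ if for all $C=(x_1,\dots,x_n)\in\mathcal B$ and all $\widetilde x_1$ with $\Psi(\widetilde x_1)=x_1$ there is a circuit $(\widetilde x_1,\dots,\widetilde x_n)$ in $\widetilde G$ with $\Psi(\widetilde x_k)=x_k$ for all $k$.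 Ordinary derived graph $G^\phi$: vertex set $V\times\Gamma$, edges $\{(u,g),(v,g\phi(uv))\}$ for $uv\in\vec E$, $g\in\Gamma$; $\Psi(u,g)=u$. Permutation derived graph $G^\sigma$ for $\phi$ with values in $S_m$, $\sigma_{uv}=\phi(uv)$: vertex set $V\times\{1,\dots,m\}$, edges $\{(u,i),(v,\sigma_{uv}(i))\}$ for $uv\in\vec E$ and $i\in\{1,\dots,m\}$; $\Psi(u,i)=u$. For $m=\infty$, $S_\infty=\mathrm{Sym}(\mathbb Z)$ and $\{1,\dots,m\}$ is replaced by $\mathbb Z$. Products of permutations along a walk are taken in the order of traversal: $\phi(x_1x_2)\phi(x_2x_3)\cdots$ means apply $\sigma_{x_1x_2}$ first, then $\sigma_{x_2x_3}$, and so on. *)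

theory Defs
  imports
    "Graph_Theory.Pair_Digraph"
    "Graph_Theory.Digraph_Component"
    "Graph_Theory.Vertex_Walk"
    "HOL-Algebra.Group"
    "HOL-Combinatorics.Permutations"
    "HOL-Library.Extended_Nat"
begin

text \<open>
  A simple undirected graph, finite or infinite, is a \<^locale>\<open>pair_bidirected_digraph\<close>: a vertex
  set with a symmetric irreflexive set of arcs, which contains both orientations of every edge.
  (The locale \<^locale>\<open>pair_graph\<close> would add finiteness, which derived graphs need not satisfy.)
  Graph connectedness is written qualified, to keep it apart from topological connectedness.
\<close>

text \<open>The circuit $(x_1,\dots,x_n)$ is the list of its vertices, without a repetition of $x_1$ at the end.\<close>

definition circuit_arcs :: "'v list \<Rightarrow> ('v \<times> 'v) list" where
  "circuit_arcs C = vwalk_arcs (C @ [hd C])"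

definition circuit :: "'v pair_pre_digraph \<Rightarrow> 'v list \<Rightarrow> bool" where
  "circuit G C \<longleftrightarrow> 3 \<le> length C \<and> distinct C \<and> vwalk (C @ [hd C]) (with_proj G)"


section \<open>Gain graphs\<close>

locale gain_graph =
  pair_bidirected_digraph G + group \<Gamma>
  for G :: "'v pair_pre_digraph" and \<phi> :: "'v \<times> 'v \<Rightarrow> 'g" and \<Gamma> :: "('g, 'r) monoid_scheme" (structure) +
  assumes gain_closed: "(u, v) \<in> parcs G \<Longrightarrow> \<phi> (u, v) \<in> carrier \<Gamma>"
    and gain_inv: "(u, v) \<in> parcs G \<Longrightarrow> \<phi> (u, v) = inv (\<phi> (v, u))"

definition circuit_gain :: "('v \<times> 'v \<Rightarrow> 'g) \<Rightarrow> ('g, 'r) monoid_scheme \<Rightarrow> 'v list \<Rightarrow> 'g" where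
  "circuit_gain \<phi> \<Gamma> C = foldr (\<lambda>a x. \<phi> a \<otimes>\<^bsub>\<Gamma>\<^esub> x) (circuit_arcs C) \<one>\<^bsub>\<Gamma>\<^esub>"

definition balanced_on :: "('v \<times> 'v \<Rightarrow> 'g) \<Rightarrow> ('g, 'r) monoid_scheme \<Rightarrow> 'v list set \<Rightarrow> bool" where
  "balanced_on \<phi> \<Gamma> B \<longleftrightarrow> (\<forall>C\<in>B. circuit_gain \<phi> \<Gamma> C = \<one>\<^bsub>\<Gamma>\<^esub>)"


section \<open>Coverings\<close>

definition neighbors :: "'v pair_pre_digraph \<Rightarrow> 'v \<Rightarrow> 'v set" where
  "neighbors G x = {y. (x, y) \<in> parcs G}"

locale covering =
  cover: pair_bidirected_digraph H + base: pair_bidirected_digraph G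
  for H :: "'w pair_pre_digraph" and \<Psi> :: "'w \<Rightarrow> 'v" and G :: "'v pair_pre_digraph" +
  assumes base_connected: "Digraph_Component.connected (with_proj G)"
    and surj_verts: "\<Psi> ` pverts H = pverts G"
    and hom_arcs: "(x, y) \<in> parcs H \<Longrightarrow> (\<Psi> x, \<Psi> y) \<in> parcs G"
    and bij_neighbors: "x \<in> pverts H \<Longrightarrow> bij_betw \<Psi> (neighbors H x) (neighbors G (\<Psi> x))"

definition covering_preserves ::
  "'w pair_pre_digraph \<Rightarrow> ('w \<Rightarrow> 'v) \<Rightarrow> 'v pair_pre_digraph \<Rightarrow> 'v list set \<Rightarrow> bool" where
  "covering_preserves H \<Psi> G B \<longleftrightarrow>
     covering H \<Psi> G \<and>
     (\<forall>C\<in>B. \<forall>x\<in>pverts H. \<Psi> x = hd C \<longrightarrow>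
        (\<exists>D. circuit H D \<and> hd D = x \<and> map \<Psi> D = C))"


section \<open>Ordinary derived graphs\<close>

text \<open>
  Both orientations of each edge of a derived graph occur in the arc sets below, the reverse of an
  arc over $uv$ being an arc over $vu$; see \<open>simple_derived_graph\<close> and \<open>simple_perm_derived_graph\<close>.
\<close>

definition derived_graph ::
  "'v pair_pre_digraph \<Rightarrow> ('v \<times> 'v \<Rightarrow> 'g) \<Rightarrow> ('g, 'r) monoid_scheme \<Rightarrow> ('v \<times> 'g) pair_pre_digraph" where
  "derived_graph G \<phi> \<Gamma> =
     \<lparr> pverts = pverts G \<times> carrier \<Gamma>,
       parcs = {((u, g), (v, g \<otimes>\<^bsub>\<Gamma>\<^esub> \<phi> (u, v))) | u v g. (u, v) \<in> parcs G \<and> g \<in> carrier \<Gamma>} \<rparr>"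

lemma (in pair_bidirected_digraph) arc_sym: "(u, v) \<in> parcs G \<Longrightarrow> (v, u) \<in> parcs G"
  using pair_sym_arcs by (auto simp: symmetric_def sym_def)

lemma (in gain_graph) simple_derived_graph: "pair_bidirected_digraph (derived_graph G \<phi> \<Gamma>)"
proof
  show "symmetric (with_proj (derived_graph G \<phi> \<Gamma>))"
    unfolding symmetric_def with_proj_simps
  proof (rule symI)
    fix x y assume "(x, y) \<in> parcs (derived_graph G \<phi> \<Gamma>)"
    then obtain u v g where *: "x = (u, g)" "y = (v, g \<otimes> \<phi> (u, v))" "(u, v) \<in> parcs G" "g \<in> carrier \<Gamma>"
      by (auto simp: derived_graph_def)
    have "(v, u) \<in> parcs G" using * arc_sym by blast
    moreover have "g \<otimes> \<phi> (u, v) \<otimes> \<phi> (v, u) = g"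
      using * calculation by (metis gain_closed gain_inv m_assoc r_inv r_one)
    ultimately show "(y, x) \<in> parcs (derived_graph G \<phi> \<Gamma>)"
      using * gain_closed by (force simp: derived_graph_def)
  qed
qed (auto simp: derived_graph_def gain_closed dest: in_arcsD1 in_arcsD2 pair_no_loops)

lemma (in gain_graph) covering_derived_graph:
  assumes "Digraph_Component.connected (with_proj G)"
  shows "covering (derived_graph G \<phi> \<Gamma>) fst G"
proof -
  interpret D: pair_bidirected_digraph "derived_graph G \<phi> \<Gamma>" by (rule simple_derived_graph)
  show ?thesis
  proof
    show "fst ` pverts (derived_graph G \<phi> \<Gamma>) = pverts G"
      using one_closed by (force simp: derived_graph_def)
  qed (use assms in \<open>auto simp: derived_graph_def neighbors_def bij_betw_def inj_on_def image_def\<close>)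
qed


section \<open>Permutation derived graphs\<close>

definition perm_points :: "enat \<Rightarrow> int set" where
  "perm_points m = (case m of enat k \<Rightarrow> {1..int k} | \<infinity> \<Rightarrow> UNIV)"

text \<open>
  Products of permutations are taken in the order of traversal (the left factor acts first), opposite
  to function composition; hence this is not the group \<open>sym_group\<close> of HOL-Algebra, which
  is moreover restricted to finite degree.
\<close>

definition symmetric_group :: "enat \<Rightarrow> (int \<Rightarrow> int) monoid" where
  "symmetric_group m =
     \<lparr> carrier = {p. p permutes perm_points m}, mult = (\<lambda>p q. q \<circ> p), one = id \<rparr>"

definition perm_derived_graph ::
  "'v pair_pre_digraph \<Rightarrow> ('v \<times> 'v \<Rightarrow> int \<Rightarrow> int) \<Rightarrow> enat \<Rightarrow> ('v \<times> int) pair_pre_digraph" where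
  "perm_derived_graph G \<sigma> m =
     \<lparr> pverts = pverts G \<times> perm_points m,
       parcs = {((u, i), (v, \<sigma> (u, v) i)) | u v i. (u, v) \<in> parcs G \<and> i \<in> perm_points m} \<rparr>"

lemma group_symmetric_group: "group (symmetric_group m)"
proof (rule groupI)
  fix p assume "p \<in> carrier (symmetric_group m)"
  then show "\<exists>q\<in>carrier (symmetric_group m). q \<otimes>\<^bsub>symmetric_group m\<^esub> p = \<one>\<^bsub>symmetric_group m\<^esub>"
    by (auto simp: symmetric_group_def intro!: exI[of _ "inv_into UNIV p"]
        dest: permutes_inv permutes_inv_o)
qed (auto simp: symmetric_group_def permutes_id permutes_compose)

lemma perm_gain_inverse:
  assumes "gain_graph G \<sigma> (symmetric_group m)" "(u, v) \<in> parcs G"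
  shows "\<sigma> (v, u) (\<sigma> (u, v) i) = i"
proof -
  interpret gain_graph G \<sigma> "symmetric_group m" by fact
  have "\<sigma> (u, v) \<otimes>\<^bsub>symmetric_group m\<^esub> \<sigma> (v, u) = \<one>\<^bsub>symmetric_group m\<^esub>"
    using assms(2) arc_sym by (metis gain_closed gain_inv r_inv)
  then show ?thesis by (auto simp: symmetric_group_def fun_eq_iff)
qed

lemma perm_gain_permutes:
  assumes "gain_graph G \<sigma> (symmetric_group m)" "(u, v) \<in> parcs G"
  shows "\<sigma> (u, v) permutes perm_points m"
  using gain_graph.gain_closed[OF assms] by (simp add: symmetric_group_def)

lemma simple_perm_derived_graph:
  assumes "gain_graph G \<sigma> (symmetric_group m)"
  shows "pair_bidirected_digraph (perm_derived_graph G \<sigma> m)"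
proof -
  interpret gain_graph G \<sigma> "symmetric_group m" by fact
  have closed: "\<sigma> (u, v) i \<in> perm_points m" if "(u, v) \<in> parcs G" "i \<in> perm_points m" for u v i
    using perm_gain_permutes[OF assms that(1)] that(2) permutes_in_image by metis
  show ?thesis
  proof
    show "symmetric (with_proj (perm_derived_graph G \<sigma> m))"
      unfolding symmetric_def with_proj_simps
    proof (rule symI)
      fix x y assume "(x, y) \<in> parcs (perm_derived_graph G \<sigma> m)"
      then obtain u v i where *: "x = (u, i)" "y = (v, \<sigma> (u, v) i)" "(u, v) \<in> parcs G" "i \<in> perm_points m"
        by (auto simp: perm_derived_graph_def)
      then show "(y, x) \<in> parcs (perm_derived_graph G \<sigma> m)"
        using perm_gain_inverse[OF assms *(3)] closed arc_sym
        by (force simp: perm_derived_graph_def)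
    qed
  qed (auto simp: perm_derived_graph_def closed dest: in_arcsD1 in_arcsD2 pair_no_loops)
qed

lemma covering_perm_derived_graph:
  assumes "gain_graph G \<sigma> (symmetric_group m)" "1 \<le> m"
    and "Digraph_Component.connected (with_proj G)"
  shows "covering (perm_derived_graph G \<sigma> m) fst G"
proof -
  interpret gain_graph G \<sigma> "symmetric_group m" by fact
  interpret D: pair_bidirected_digraph "perm_derived_graph G \<sigma> m"
    by (rule simple_perm_derived_graph) fact
  have "1 \<in> perm_points m"
    using assms(2) by (cases m) (auto simp: perm_points_def one_enat_def)
  show ?thesis
  proof
    show "fst ` pverts (perm_derived_graph G \<sigma> m) = pverts G"
      using \<open>1 \<in> perm_points m\<close> by (force simp: perm_derived_graph_def)
  qed (use assms in \<open>auto simp: perm_derived_graph_def neighbors_def bij_betw_def inj_on_def image_def\<close>)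
qed

end

theory Submission
  imports Defs
begin

text \<open>
  Both derived graphs are instances of one construction: every arc $a$ of $G$ acts on a fibre $F$ by
  a map $t_a$, and an arc $uv$ of $G$ is covered by the arcs from $(u,i)$ to $(v,t_{uv}(i))$. For the
  ordinary derived graph $F$ is the group and $t_a$ is right multiplication by the gain of $a$; for
  the permutation derived graph $F$ is the set of points and $t_a$ is the gain itself.

  In such a graph a walk of $G$ has a lift from every point over its initial vertex
  (\<open>action_graph_walk_lift\<close>), and a lift is governed by the maps $t_a$: its end is the
  image of its initial fibre point under the transport along the arcs traversed
  (\<open>action_graph_walk_transport\<close>). Hence a circuit lifts to a circuit
  from $(x_1,i)$ exactly when its transport fixes $i$ (\<open>circuit_lift_iff\<close>). So the covering
  preserves a set of circuits exactly when every transport along one of them is the identity on the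
  whole fibre (\<open>preserves_iff_transport_trivial\<close>).

  The transport along a circuit is the action of the gain of that circuit, and both
  actions are faithful: right multiplication by $h$ that fixes one group element forces
  $h = 1$, and a permutation is the identity as soon as it fixes all points of its domain. Therefore
  trivial transport means trivial gain.
\<close>

section \<open>Graphs derived from an action on a fibre\<close>

definition action_graph ::
  "'v pair_pre_digraph \<Rightarrow> ('v \<times> 'v \<Rightarrow> 'f \<Rightarrow> 'f) \<Rightarrow> 'f set \<Rightarrow> ('v \<times> 'f) pair_pre_digraph" where
  "action_graph G t F =
     \<lparr> pverts = pverts G \<times> F,
       parcs = {((u, i), (v, t (u, v) i)) | u v i. (u, v) \<in> parcs G \<and> i \<in> F} \<rparr>"

lemma derived_graph_eq_action_graph:
  "derived_graph G \<phi> \<Gamma> = action_graph G (\<lambda>a g. g \<otimes>\<^bsub>\<Gamma>\<^esub> \<phi> a) (carrier \<Gamma>)"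
  by (simp add: derived_graph_def action_graph_def)

lemma perm_derived_graph_eq_action_graph:
  "perm_derived_graph G \<sigma> m = action_graph G \<sigma> (perm_points m)"
  by (simp add: perm_derived_graph_def action_graph_def)

text \<open>
  Each arc of an action graph determines the fibre coordinate of its head from that of its tail, so
  the end of a walk is determined by its projection and its start.
\<close>

lemma action_graph_walk_transport:
  assumes "vwalk W (with_proj (action_graph G t F))"
  shows "snd (last W) = fold t (vwalk_arcs (map fst W)) (snd (hd W))"
  using assms
proof (induction W rule: vwalk_arcs.induct)
  case (3 x y W)
  then have "vwalk (y # W) (with_proj (action_graph G t F))"
    and "snd y = t (fst x, fst y) (snd x)"
    by (auto simp: vwalk_def action_graph_def)
  with "3.IH" show ?case by simp
qed (auto simp: vwalk_def)

lemma action_graph_walk_lift: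
  assumes "vwalk W (with_proj G)"
    and "\<And>a i. a \<in> parcs G \<Longrightarrow> i \<in> F \<Longrightarrow> t a i \<in> F"
    and "i \<in> F"
  shows "\<exists>W'. vwalk W' (with_proj (action_graph G t F)) \<and> hd W' = (hd W, i) \<and> map fst W' = W"
  using assms(1,3)
proof (induction W arbitrary: i rule: vwalk_arcs.induct)
  case (2 u)
  then show ?case
    by (intro exI[of _ "[(u, i)]"]) (auto simp: vwalk_def action_graph_def)
next
  case (3 u v W)
  then have uv: "(u, v) \<in> parcs G" "u \<in> pverts G" and "vwalk (v # W) (with_proj G)"
    by (auto simp: vwalk_def)
  moreover have "t (u, v) i \<in> F" using assms(2) uv "3.prems" by blast
  ultimately obtain W' where W': "vwalk W' (with_proj (action_graph G t F))"
    "hd W' = (v, t (u, v) i)" "map fst W' = v # W"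
    using "3.IH"[of "t (u, v) i"] by auto
  then obtain W'' where "W' = (v, t (u, v) i) # W''" by (cases W') auto
  with W' uv "3.prems" show ?case
    by (intro exI[of _ "(u, i) # W'"]) (auto simp: vwalk_def action_graph_def)
qed (auto simp: vwalk_def)

text \<open>
  The closed walk around \<open>C\<close> has a lift from \<open>(hd C, i)\<close>, and that lift closes up
  if and only if transport brings \<open>i\<close> back to itself. Its vertices are then distinct
  because their projections are.
\<close>

lemma circuit_lift_iff:
  assumes C: "circuit G C"
    and closed: "\<And>a i. a \<in> parcs G \<Longrightarrow> i \<in> F \<Longrightarrow> t a i \<in> F"
    and i: "i \<in> F"
  shows "(\<exists>D. circuit (action_graph G t F) D \<and> hd D = (hd C, i) \<and> map fst D = C) \<longleftrightarrow>
         fold t (circuit_arcs C) i = i"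
    (is "?lifts \<longleftrightarrow> _")
proof
  assume ?lifts
  then obtain D where D: "circuit (action_graph G t F) D" "hd D = (hd C, i)" "map fst D = C"
    by blast
  then have "vwalk (D @ [hd D]) (with_proj (action_graph G t F))" and "D \<noteq> []"
    by (auto simp: circuit_def)
  from action_graph_walk_transport[OF this(1)] this(2) D show "fold t (circuit_arcs C) i = i"
    by (simp add: circuit_arcs_def)
next
  assume fixed: "fold t (circuit_arcs C) i = i"
  from C have walk: "vwalk (C @ [hd C]) (with_proj G)" and "C \<noteq> []"
    by (auto simp: circuit_def)
  from action_graph_walk_lift[where t = t and F = F, OF walk closed i] \<open>C \<noteq> []\<close>
  obtain W where W: "vwalk W (with_proj (action_graph G t F))" "hd W = (hd C, i)"
    "map fst W = C @ [hd C]" by auto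
  then obtain D w where D: "W = D @ [w]" "map fst D = C" "fst w = hd C"
    by (auto simp: map_eq_append_conv)
  with \<open>C \<noteq> []\<close> have "D \<noteq> []" by auto
  have "snd w = i"
    using action_graph_walk_transport[OF W(1)] W(2,3) D(1) fixed by (simp add: circuit_arcs_def)
  with W(2) D \<open>D \<noteq> []\<close> have "w = hd D" by (simp add: prod_eq_iff)
  moreover have "distinct D" "3 \<le> length D"
    using C D(2) by (auto simp: circuit_def distinct_map)
  ultimately show ?lifts
    using W(1,2) D \<open>D \<noteq> []\<close> by (intro exI[of _ D]) (simp add: circuit_def)
qed

lemma circuit_arcs_subset:
  assumes "circuit G C"
  shows "set (circuit_arcs C) \<subseteq> parcs G"
  using assms by (auto simp: circuit_def circuit_arcs_def vwalk_def)

lemma preserves_iff_transport_trivial: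
  assumes "covering (action_graph G t F) fst G"
    and circuits: "\<forall>C\<in>B. circuit G C"
    and closed: "\<And>a i. a \<in> parcs G \<Longrightarrow> i \<in> F \<Longrightarrow> t a i \<in> F"
  shows "covering_preserves (action_graph G t F) fst G B \<longleftrightarrow>
         (\<forall>C\<in>B. \<forall>i\<in>F. fold t (circuit_arcs C) i = i)"
proof -
  have "(\<forall>x\<in>pverts (action_graph G t F). fst x = hd C \<longrightarrow>
           (\<exists>D. circuit (action_graph G t F) D \<and> hd D = x \<and> map fst D = C)) \<longleftrightarrow>
        (\<forall>i\<in>F. fold t (circuit_arcs C) i = i)" if "C \<in> B" for C
  proof -
    have C: "circuit G C" using circuits that by blast
    then have "hd C \<in> pverts G" by (auto simp: circuit_def vwalk_def)
    then have "(\<forall>x\<in>pverts (action_graph G t F). fst x = hd C \<longrightarrow> P x) \<longleftrightarrow> (\<forall>i\<in>F. P (hd C, i))" for P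
      by (auto simp: action_graph_def)
    with circuit_lift_iff[where t = t and F = F, OF C closed] show ?thesis by simp
  qed
  with assms(1) show ?thesis by (auto simp: covering_preserves_def)
qed

section \<open>Transport as the action of the gain\<close>

lemma (in gain_graph) foldr_gain_closed:
  assumes "set as \<subseteq> parcs G"
  shows "foldr (\<lambda>a x. \<phi> a \<otimes> x) as \<one> \<in> carrier \<Gamma>"
  using assms by (induction as) (auto simp: gain_closed)

lemma (in gain_graph) circuit_gain_closed:
  assumes "circuit G C"
  shows "circuit_gain \<phi> \<Gamma> C \<in> carrier \<Gamma>"
  using foldr_gain_closed[OF circuit_arcs_subset[OF assms]] by (simp add: circuit_gain_def)

lemma (in gain_graph) right_mult_transport:
  assumes "circuit G C" "g \<in> carrier \<Gamma>"
  shows "fold (\<lambda>a g. g \<otimes> \<phi> a) (circuit_arcs C) g = g \<otimes> circuit_gain \<phi> \<Gamma> C"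
proof -
  have "fold (\<lambda>a g. g \<otimes> \<phi> a) as g = g \<otimes> foldr (\<lambda>a x. \<phi> a \<otimes> x) as \<one>"
    if "set as \<subseteq> parcs G" for as
    using that assms(2)
    by (induction as arbitrary: g) (auto simp: gain_closed foldr_gain_closed m_assoc)
  with circuit_arcs_subset[OF assms(1)] show ?thesis by (simp add: circuit_gain_def)
qed

text \<open>
  The left factor of a product in the symmetric group acts first, so the gain of a circuit applies
  the gains of its arcs in the order in which transport does.
\<close>

lemma perm_transport:
  "fold \<sigma> (circuit_arcs C) i = circuit_gain \<sigma> (symmetric_group m) C i"
proof -
  have "fold \<sigma> as i = foldr (\<lambda>a x. \<sigma> a \<otimes>\<^bsub>symmetric_group m\<^esub> x) as \<one>\<^bsub>symmetric_group m\<^esub> i" for as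
    by (induction as arbitrary: i) (auto simp: symmetric_group_def)
  then show ?thesis by (simp add: circuit_gain_def)
qed

section \<open>Balance and preservation of circuits\<close>

lemma (in gain_graph) balanced_iff_derived_covering_preserves:
  assumes "Digraph_Component.connected (with_proj G)" "\<forall>C\<in>B. circuit G C"
  shows "balanced_on \<phi> \<Gamma> B \<longleftrightarrow> covering_preserves (derived_graph G \<phi> \<Gamma>) fst G B"
proof -
  have "covering_preserves (derived_graph G \<phi> \<Gamma>) fst G B \<longleftrightarrow>
        (\<forall>C\<in>B. \<forall>g\<in>carrier \<Gamma>. fold (\<lambda>a g. g \<otimes> \<phi> a) (circuit_arcs C) g = g)"
    unfolding derived_graph_eq_action_graph
    using covering_derived_graph[OF assms(1), unfolded derived_graph_eq_action_graph] assms(2)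
    by (rule preserves_iff_transport_trivial) (auto simp: gain_closed)
  also have "\<dots> \<longleftrightarrow> (\<forall>C\<in>B. \<forall>g\<in>carrier \<Gamma>. g \<otimes> circuit_gain \<phi> \<Gamma> C = g)"
    using assms(2) by (simp add: right_mult_transport)
  also have "\<dots> \<longleftrightarrow> balanced_on \<phi> \<Gamma> B"
    using assms(2) one_closed by (auto simp: balanced_on_def circuit_gain_closed)
  finally show ?thesis by simp
qed

lemma balanced_iff_perm_derived_covering_preserves:
  assumes gain: "gain_graph G \<sigma> (symmetric_group m)" and "1 \<le> m"
    and "Digraph_Component.connected (with_proj G)" "\<forall>C\<in>B. circuit G C"
  shows "balanced_on \<sigma> (symmetric_group m) B \<longleftrightarrow>
         covering_preserves (perm_derived_graph G \<sigma> m) fst G B"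
proof -
  interpret gain_graph G \<sigma> "symmetric_group m" by fact
  have closed: "\<sigma> a i \<in> perm_points m" if "a \<in> parcs G" "i \<in> perm_points m" for a i
    using perm_gain_permutes[OF gain, of "fst a" "snd a"] that by (simp add: permutes_in_image)
  \<comment> \<open>Permutations are functions on all integers, but they fix everything outside their domain.\<close>
  have trivial: "circuit_gain \<sigma> (symmetric_group m) C = id \<longleftrightarrow>
      (\<forall>i\<in>perm_points m. circuit_gain \<sigma> (symmetric_group m) C i = i)" if "C \<in> B" for C
  proof -
    have "circuit_gain \<sigma> (symmetric_group m) C permutes perm_points m"
      using circuit_gain_closed[of C] assms(4) that by (simp add: symmetric_group_def)
    then show ?thesis by (auto simp: fun_eq_iff dest: permutes_not_in)
  qed
  have "covering_preserves (perm_derived_graph G \<sigma> m) fst G B \<longleftrightarrow>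
        (\<forall>C\<in>B. \<forall>i\<in>perm_points m. fold \<sigma> (circuit_arcs C) i = i)"
    unfolding perm_derived_graph_eq_action_graph
    using covering_perm_derived_graph[OF assms(1-3), unfolded perm_derived_graph_eq_action_graph]
      assms(4) closed
    by (rule preserves_iff_transport_trivial)
  also have "\<dots> \<longleftrightarrow> balanced_on \<sigma> (symmetric_group m) B"
    using trivial
    by (simp add: perm_transport[of \<sigma> _ _ m] balanced_on_def symmetric_group_def)
  finally show ?thesis by simp
qed

theorem corollary4p4:
  fixes G :: "'v pair_pre_digraph"
    and \<phi> :: "'v \<times> 'v \<Rightarrow> 'g" and \<Gamma> :: "('g, 'r) monoid_scheme"
    and \<sigma> :: "'v \<times> 'v \<Rightarrow> int \<Rightarrow> int" and m :: enat
    and B :: "'v list set"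
  assumes "pair_bidirected_digraph G"
    and "Digraph_Component.connected (with_proj G)"
    and "\<forall>C\<in>B. circuit G C"
  shows "(gain_graph G \<phi> \<Gamma> \<longrightarrow>
            (balanced_on \<phi> \<Gamma> B \<longleftrightarrow> covering_preserves (derived_graph G \<phi> \<Gamma>) fst G B)) \<and>
         (1 \<le> m \<and> gain_graph G \<sigma> (symmetric_group m) \<longrightarrow>
            (balanced_on \<sigma> (symmetric_group m) B \<longleftrightarrow>
             covering_preserves (perm_derived_graph G \<sigma> m) fst G B))"
proof (intro conjI impI)
  assume "gain_graph G \<phi> \<Gamma>"
  then show "balanced_on \<phi> \<Gamma> B \<longleftrightarrow> covering_preserves (derived_graph G \<phi> \<Gamma>) fst G B"
    using assms(2,3) by (rule gain_graph.balanced_iff_derived_covering_preserves)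
next
  assume "1 \<le> m \<and> gain_graph G \<sigma> (symmetric_group m)"
  then show "balanced_on \<sigma> (symmetric_group m) B \<longleftrightarrow>
      covering_preserves (perm_derived_graph G \<sigma> m) fst G B"
    by (intro balanced_iff_perm_derived_covering_preserves assms(2,3)) simp_all
qed

end
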